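(* Let $(X,\mathcal F,\mu)$ be a measure space with $\mu$ sigma-finite, and let $W^{(\mu)}$ be a $\mu$-Brownian motion on a probability space $(\Omega,\mathcal C,\mathbb P)$ with It\^o isometry $V_\mu:\mathbf L^2(X,\mathcal F,\mu)\to\mathbf L^2(\Omega,\mathcal C,\mathbb P)$. Then the adjoint of $V_\mu$ is given by $$V_\mu^*\psi=\nabla_\mu\,\mathbb E(\psi W^{(\mu)}_\cdot),\quad \psi\in\mathbf L^2(\Omega,\mathcal C,\mathbb P),$$ i.e. for each such $\psi$ the function $A\mapsto\mathbb E(\psi W^{(\mu)}_A)$ on $\mathcal F^{\rm fin}$ belongs to $\mathfrak H(\mu)$ and $V_\mu^*\psi$ is its image under $\nabla_\mu$.
   Context: $\mathcal F^{\rm fin}=\{A\in\mathcal F:\mu(A)<\infty\}$. $\mathfrak H(\mu)$ is the reproducing kernel Hilbert space of complex functions on $\mathcal F^{\rm fin}$ with reproducing kernel $\mu(A\cap B)$; it is known to consist exactly of the functions $M(A)=\int_Ah\,d\mu$ with $h\in\mathbf L^2(X,\mathcal F,\mu)$, with norm $\|M\|=\|h\|_2$. The Krein-Feller derivative $\nabla_\mu:\mathfrak H(\mu)\to\mathbf L^2(X,\mathcal F,\mu)$ sends $M$ to this (unique) $h$. A $\mu$-Brownian motion is a real-valued centered Gaussian family $(W^{(\mu)}_A)_{A\in\mathcal F^{\rm fin}}$ in $\mathbf L^2(\Omega,\mathcal C,\mathbb P)$ (complex $L^2$ space) with $\mathbb E(W^{(\mu)}_AW^{(\mu)}_B)=\mu(A\cap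 B)$ for all $A,B\in\mathcal F^{\rm fin}$. The It\^o isometry $V_\mu h=\int_Xh(x)\,dW^{(\mu)}_x$ is the unique continuous linear map $\mathbf L^2(X,\mathcal F,\mu)\to\mathbf L^2(\Omega,\mathcal C,\mathbb P)$ with $V_\mu1_A=W^{(\mu)}_A$ for $A\in\mathcal F^{\rm fin}$; it is known to be an isometry. *)

theory Defs
  imports "HOL-Probability.Probability"
begin

section \<open>Complex square-integrable functions\<close>

text \<open>
  Elements of the complex Hilbert space L2 are handled through representatives; two
  representatives are identified when they agree almost everywhere.
  Inner products are linear in the first argument.
\<close>

definition L2_space :: "'a measure \<Rightarrow> ('a \<Rightarrow> complex) set" where
  "L2_space M = {f \<in> borel_measurable M. integrable M (\<lambda>x. (cmod (f x))\<^sup>2)}"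

definition L2_inner :: "'a measure \<Rightarrow> ('a \<Rightarrow> complex) \<Rightarrow> ('a \<Rightarrow> complex) \<Rightarrow> complex" where
  "L2_inner M f g = (\<integral>x. f x * cnj (g x) \<partial>M)"

definition L2_norm :: "'a measure \<Rightarrow> ('a \<Rightarrow> complex) \<Rightarrow> real" where
  "L2_norm M f = sqrt (\<integral>x. (cmod (f x))\<^sup>2 \<partial>M)"

definition L2_linear ::
  "'a measure \<Rightarrow> 'b measure \<Rightarrow> (('a \<Rightarrow> complex) \<Rightarrow> 'b \<Rightarrow> complex) \<Rightarrow> bool" where
  "L2_linear M N V \<longleftrightarrow>
    (\<forall>f \<in> L2_space M. \<forall>g \<in> L2_space M. \<forall>a b.
       AE y in N. V (\<lambda>x. a * f x + b * g x) y = a * V f y + b * V g y)"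

text \<open>
  Taking \<open>g\<close> almost everywhere equal to \<open>f\<close> shows that an operator that is continuous in this
  sense respects almost everywhere equality, and so acts on classes.
\<close>

definition L2_continuous ::
  "'a measure \<Rightarrow> 'b measure \<Rightarrow> (('a \<Rightarrow> complex) \<Rightarrow> 'b \<Rightarrow> complex) \<Rightarrow> bool" where
  "L2_continuous M N V \<longleftrightarrow>
    (\<forall>f \<in> L2_space M. \<forall>e > 0. \<exists>d > 0. \<forall>g \<in> L2_space M.
       L2_norm M (\<lambda>x. g x - f x) < d \<longrightarrow> L2_norm N (\<lambda>y. V g y - V f y) < e)"

definition is_L2_adjoint ::
  "'a measure \<Rightarrow> 'b measure \<Rightarrow> (('a \<Rightarrow> complex) \<Rightarrow> 'b \<Rightarrow> complex)
    \<Rightarrow> (('b \<Rightarrow> complex) \<Rightarrow> 'a \<Rightarrow> complex) \<Rightarrow> bool" where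
  "is_L2_adjoint M N V V' \<longleftrightarrow>
    V' \<in> L2_space N \<rightarrow> L2_space M \<and>
    (\<forall>h \<in> L2_space M. \<forall>\<psi> \<in> L2_space N. L2_inner N (V h) \<psi> = L2_inner M h (V' \<psi>))"


section \<open>Reproducing kernel Hilbert spaces of complex functions\<close>

text \<open>
  Functions on \<open>T\<close> are normalised to be \<open>undefined\<close> outside \<open>T\<close>, so that equality of functions
  on \<open>T\<close> is equality in HOL.
\<close>

locale function_hilbert_space =
  fixes T :: "'t set"
    and H :: "('t \<Rightarrow> complex) set"
    and ip :: "('t \<Rightarrow> complex) \<Rightarrow> ('t \<Rightarrow> complex) \<Rightarrow> complex"
  assumes carrier: "H \<subseteq> extensional T"
    and zero_mem: "(\<lambda>t\<in>T. 0) \<in> H"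
    and add_mem: "f \<in> H \<Longrightarrow> g \<in> H \<Longrightarrow> (\<lambda>t\<in>T. f t + g t) \<in> H"
    and scale_mem: "f \<in> H \<Longrightarrow> (\<lambda>t\<in>T. a * f t) \<in> H"
    and ip_add: "f \<in> H \<Longrightarrow> g \<in> H \<Longrightarrow> k \<in> H \<Longrightarrow> ip (\<lambda>t\<in>T. f t + g t) k = ip f k + ip g k"
    and ip_scale: "f \<in> H \<Longrightarrow> g \<in> H \<Longrightarrow> ip (\<lambda>t\<in>T. a * f t) g = a * ip f g"
    and ip_cnj: "f \<in> H \<Longrightarrow> g \<in> H \<Longrightarrow> ip g f = cnj (ip f g)"
    and ip_nonneg: "f \<in> H \<Longrightarrow> 0 \<le> Re (ip f f)"
    and ip_definite: "f \<in> H \<Longrightarrow> ip f f = 0 \<Longrightarrow> f = (\<lambda>t\<in>T. 0)"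
    and complete:
      "(\<And>n. F n \<in> H) \<Longrightarrow>
       (\<And>e. 0 < e \<Longrightarrow> \<exists>N. \<forall>m\<ge>N. \<forall>n\<ge>N.
          sqrt (Re (ip (\<lambda>t\<in>T. F m t - F n t) (\<lambda>t\<in>T. F m t - F n t))) < e) \<Longrightarrow>
       \<exists>f\<in>H. (\<lambda>n. sqrt (Re (ip (\<lambda>t\<in>T. F n t - f t) (\<lambda>t\<in>T. F n t - f t)))) \<longlonglongrightarrow> 0"

definition has_reproducing_kernel ::
  "'t set \<Rightarrow> ('t \<Rightarrow> complex) set \<Rightarrow> (('t \<Rightarrow> complex) \<Rightarrow> ('t \<Rightarrow> complex) \<Rightarrow> complex)
    \<Rightarrow> ('t \<Rightarrow> 't \<Rightarrow> complex) \<Rightarrow> bool" where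
  "has_reproducing_kernel T H ip K \<longleftrightarrow>
    (\<forall>t\<in>T. (\<lambda>s\<in>T. K s t) \<in> H \<and> (\<forall>f\<in>H. ip f (\<lambda>s\<in>T. K s t) = f t))"

text \<open>
  By the Moore--Aronszajn theorem exactly one such \<open>H\<close> exists for each positive definite \<open>K\<close>.
\<close>

definition rkhs :: "'t set \<Rightarrow> ('t \<Rightarrow> 't \<Rightarrow> complex) \<Rightarrow> ('t \<Rightarrow> complex) set" where
  "rkhs T K = (THE H. \<exists>ip. function_hilbert_space T H ip \<and> has_reproducing_kernel T H ip K)"


section \<open>The space of a measure and the Krein-Feller derivative\<close>

definition fin_sets :: "'a measure \<Rightarrow> 'a set set" where
  "fin_sets M = {A \<in> sets M. emeasure M A < \<infinity>}"

definition measure_rkhs :: "'a measure \<Rightarrow> ('a set \<Rightarrow> complex) set" where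
  "measure_rkhs M = rkhs (fin_sets M) (\<lambda>A B. complex_of_real (measure M (A \<inter> B)))"

text \<open>
  For sigma-finite \<open>\<mu>\<close> the representative chosen here is determined up to
  \<open>\<mu>\<close>-null sets; the definition is meaningful for \<open>M \<in> measure_rkhs \<mu>\<close>.
\<close>

definition krein_feller :: "'a measure \<Rightarrow> ('a set \<Rightarrow> complex) \<Rightarrow> 'a \<Rightarrow> complex" where
  "krein_feller \<mu> M =
    (SOME h. h \<in> L2_space \<mu> \<and> (\<forall>A \<in> fin_sets \<mu>. M A = (LINT x:A|\<mu>. h x)))"


section \<open>Brownian motion indexed by a measure and the Ito isometry\<close>

text \<open>Gaussian variables may be degenerate, i.e. almost surely constant.\<close>

definition gaussian_rv :: "'w measure \<Rightarrow> ('w \<Rightarrow> real) \<Rightarrow> bool" where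
  "gaussian_rv P Y \<longleftrightarrow>
    Y \<in> borel_measurable P \<and>
    ((\<exists>m \<sigma>. 0 < \<sigma> \<and> distributed P lborel Y (normal_density m \<sigma>)) \<or>
     (\<exists>m. AE \<omega> in P. Y \<omega> = m))"

definition gaussian_family :: "'w measure \<Rightarrow> 'i set \<Rightarrow> ('i \<Rightarrow> 'w \<Rightarrow> real) \<Rightarrow> bool" where
  "gaussian_family P I Y \<longleftrightarrow>
    (\<forall>J c. finite J \<longrightarrow> J \<subseteq> I \<longrightarrow> gaussian_rv P (\<lambda>\<omega>. \<Sum>i\<in>J. c i * Y i \<omega>))"

definition brownian_motion :: "'a measure \<Rightarrow> 'w measure \<Rightarrow> ('a set \<Rightarrow> 'w \<Rightarrow> real) \<Rightarrow> bool" where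
  "brownian_motion \<mu> P W \<longleftrightarrow>
    gaussian_family P (fin_sets \<mu>) W \<and>
    (\<forall>A \<in> fin_sets \<mu>. (\<lambda>\<omega>. complex_of_real (W A \<omega>)) \<in> L2_space P) \<and>
    (\<forall>A \<in> fin_sets \<mu>. (\<integral>\<omega>. W A \<omega> \<partial>P) = 0) \<and>
    (\<forall>A \<in> fin_sets \<mu>. \<forall>B \<in> fin_sets \<mu>. (\<integral>\<omega>. W A \<omega> * W B \<omega> \<partial>P) = measure \<mu> (A \<inter> B))"

definition is_ito_isometry ::
  "'a measure \<Rightarrow> 'w measure \<Rightarrow> ('a set \<Rightarrow> 'w \<Rightarrow> real)
    \<Rightarrow> (('a \<Rightarrow> complex) \<Rightarrow> 'w \<Rightarrow> complex) \<Rightarrow> bool" where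
  "is_ito_isometry \<mu> P W V \<longleftrightarrow>
    V \<in> L2_space \<mu> \<rightarrow> L2_space P \<and> L2_linear \<mu> P V \<and> L2_continuous \<mu> P V \<and>
    (\<forall>A \<in> fin_sets \<mu>. AE \<omega> in P. V (indicator A) \<omega> = complex_of_real (W A \<omega>))"

end

(* The functional M \<mapsto> <V (\<nabla> M), \<psi>> on the Hilbert space of set functions is linear and bounded, so
   it is represented by some M' = (A \<mapsto> \<integral>_A k d\<mu>); that is, <V h, \<psi>> = <h, k> for all h, and k = V* \<psi>.
   Taking h = 1_A gives M'(A) = E(\<psi> W_A). The set functions A \<mapsto> \<integral>_A h d\<mu> do form the reproducing kernel Hilbert space because
   they form some Hilbert space (L2 is complete, and h is determined by its integrals over sets of
   finite measure) with the right kernel, and a kernel determines its space. *)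

theory Submission
  imports Defs
begin

section \<open>Riesz representation and uniqueness of the reproducing kernel Hilbert space\<close>

text \<open>Elements of L2 are representatives here, so the L2 inner product is definite only up to
  null sets, while \<open>function_hilbert_space\<close> wants definiteness as equality of
  functions. Passing from a density to its set function removes this mismatch: densities that agree
  almost everywhere give one and the same function. Hence the Riesz argument runs on set functions.
  It is used a second time to show that a kernel determines its space. There the functional lives on
  a subspace carrying two inner products, not known to be closed or dense in either space. This
  dictates the form of the Riesz theorem: a functional on a subspace, represented by a vector of the
  surrounding space.\<close>

text \<open>Evaluate at the minimiser if \<open>c > 0\<close>; a negative \<open>c\<close> is
  excluded by growth, and \<open>c = 0\<close> leaves a linear function, which must be constant.
  Besides the Cauchy-Schwarz inequalities this yields the stationarity condition in the Riesz
  theorem: \<open>a = 0\<close> forces \<open>b = 0\<close>.\<close>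

lemma nonneg_quadratic_discriminant:
  fixes a b c :: real
  assumes "\<And>t. 0 \<le> a + 2 * t * b + t\<^sup>2 * c"
  shows "b\<^sup>2 \<le> a * c"
proof (cases "c = 0")
  case True
  have "b = 0"
  proof (rule ccontr)
    assume "b \<noteq> 0"
    \<comment> \<open>At this point the linear function takes the value -1.\<close>
    with assms[of "- (a + 1) / (2 * b)"] True show False by (simp add: field_simps)
  qed
  with True show ?thesis by simp
next
  case False
  have "0 \<le> c"
  proof (rule ccontr)
    assume "\<not> 0 \<le> c"
    then have neg: "c < 0" by simp
    \<comment> \<open>Adding the values at \<open>s\<close> and \<open>-s\<close> cancels the term
      in \<open>b\<close>. The summand 1 gives \<open>s \<ge> 1\<close>, so the square of
      \<open>s\<close> may be replaced by \<open>s\<close>; the fraction is sized to outweigh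
      \<open>a\<close>.\<close>
    define s where "s = (\<bar>a\<bar> + 1) / - c + 1"
    have "s \<ge> 1" using neg by (simp add: s_def divide_nonneg_nonpos divide_nonpos_neg divide_simps)
    then have "s \<le> s\<^sup>2" by (simp add: power2_eq_square)
    then have "s\<^sup>2 * c \<le> s * c" using neg by (simp add: mult_right_mono_neg)
    also have "s * c = - (\<bar>a\<bar> + 1) + c" using neg by (simp add: s_def field_simps)
    finally have "a + s\<^sup>2 * c < 0" using neg by linarith
    moreover have "0 \<le> 2 * (a + s\<^sup>2 * c)" using assms[of s] assms[of "-s"] by simp
    ultimately show False by (simp add: zero_le_mult_iff)
  qed
  with False have "c > 0" by simp
  then show ?thesis using assms[of "- b / c"]
    by (simp add: field_simps power2_eq_square)
qed

section \<open>Cauchy-Schwarz inequality and Riesz representation in a Hilbert space of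
  functions\<close>

context function_hilbert_space
begin

text \<open>Sums, differences, midpoints and the perturbations \<open>F n + t * h\<close> of the
  Riesz argument are all instances, so one set of rules for \<open>ip\<close> covers them.\<close>

definition lincomb :: "complex \<Rightarrow> ('t \<Rightarrow> complex) \<Rightarrow> complex \<Rightarrow> ('t \<Rightarrow> complex) \<Rightarrow> 't \<Rightarrow> complex"
  where "lincomb a f b g = (\<lambda>t\<in>T. a * f t + b * g t)"

lemma lincomb_eq: "lincomb a f b g = (\<lambda>t\<in>T. (\<lambda>t\<in>T. a * f t) t + (\<lambda>t\<in>T. b * g t) t)"
  by (auto simp: lincomb_def)

lemma diff_eq_lincomb: "(\<lambda>t\<in>T. f t - g t) = lincomb 1 f (-1) g"
  unfolding lincomb_def by simp

lemma lincomb_mem: "f \<in> H \<Longrightarrow> g \<in> H \<Longrightarrow> lincomb a f b g \<in> H"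
  unfolding lincomb_eq by (intro add_mem scale_mem)

lemma ip_lincomb_left:
  assumes "f \<in> H" "g \<in> H" "k \<in> H"
  shows "ip (lincomb a f b g) k = a * ip f k + b * ip g k"
  unfolding lincomb_eq using assms by (simp only: ip_add ip_scale scale_mem)

lemma ip_lincomb_right:
  assumes "f \<in> H" "g \<in> H" "k \<in> H"
  shows "ip k (lincomb a f b g) = cnj a * ip k f + cnj b * ip k g"
  using assms ip_cnj[of "lincomb a f b g" k] ip_cnj[of f k] ip_cnj[of g k]
  by (simp add: lincomb_mem ip_lincomb_left)

text \<open>For real scalars the two cross terms are conjugate and add up to a real part, which
  makes the squared norm a real quadratic form.\<close>

lemma norm_lincomb:
  assumes "f \<in> H" "g \<in> H"
  shows "Re (ip (lincomb (of_real a) f (of_real b) g) (lincomb (of_real a) f (of_real b) g)) =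
    a\<^sup>2 * Re (ip f f) + 2 * a * b * Re (ip f g) + b\<^sup>2 * Re (ip g g)"
  using assms ip_cnj[of f g]
  by (simp add: lincomb_mem ip_lincomb_left ip_lincomb_right algebra_simps power2_eq_square)

lemma Re_Cauchy_Schwarz:
  assumes "f \<in> H" "g \<in> H"
  shows "\<bar>Re (ip f g)\<bar> \<le> sqrt (Re (ip f f)) * sqrt (Re (ip g g))"
proof -
  have "(Re (ip f g))\<^sup>2 \<le> Re (ip f f) * Re (ip g g)"
  proof (rule nonneg_quadratic_discriminant)
    fix t :: real
    have "0 \<le> Re (ip (lincomb (of_real 1) f (of_real t) g) (lincomb (of_real 1) f (of_real t) g))"
      using assms by (intro ip_nonneg lincomb_mem)
    then show "0 \<le> Re (ip f f) + 2 * t * Re (ip f g) + t\<^sup>2 * Re (ip g g)"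
      unfolding norm_lincomb[OF assms] by simp
  qed
  then have "sqrt ((Re (ip f g))\<^sup>2) \<le> sqrt (Re (ip f f) * Re (ip g g))"
    by (rule real_sqrt_le_mono)
  then show ?thesis by (simp add: real_sqrt_mult)
qed

text \<open>The representing vector is the limit of a minimising sequence of
  \<open>\<parallel>h\<parallel>\<^sup>2 - 2 Re (l h)\<close> over \<open>S\<close>; it need not lie in \<open>S\<close>, which is why \<open>S\<close> need not be closed.\<close>

theorem Riesz_subspace:
  assumes S: "S \<subseteq> H" "S \<noteq> {}"
    and S_lincomb: "\<And>a b f g. f \<in> S \<Longrightarrow> g \<in> S \<Longrightarrow> (\<lambda>t\<in>T. a * f t + b * g t) \<in> S"
    and l_lincomb: "\<And>a b f g. f \<in> S \<Longrightarrow> g \<in> S \<Longrightarrow>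
      l (\<lambda>t\<in>T. a * f t + b * g t) = a * l f + b * l g"
    and l_bound: "\<And>f. f \<in> S \<Longrightarrow> Re (l f) \<le> C * sqrt (Re (ip f f))"
  shows "\<exists>k\<in>H. \<forall>h\<in>S. ip h k = l h"
proof -
  note S_lc = S_lincomb[folded lincomb_def] and l_lc = l_lincomb[folded lincomb_def]
  have SH: "f \<in> H" if "f \<in> S" for f using that S by blast
  define J where "J f = Re (ip f f) - 2 * Re (l f)" for f
  have J_lower: "- C\<^sup>2 \<le> J f" if "f \<in> S" for f
  proof -
    define r where "r = sqrt (Re (ip f f))"
    have "Re (ip f f) = r\<^sup>2" using ip_nonneg[OF SH[OF that]] by (simp add: r_def)
    moreover have "Re (l f) \<le> C * r" using l_bound[OF that] by (simp add: r_def)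
    \<comment> \<open>Completing the square: \<open>r * r - 2 * C * r\<close> is at least
      \<open>- C * C\<close>.\<close>
    moreover have "0 \<le> (r - C)\<^sup>2" by simp
    ultimately show ?thesis unfolding J_def by (simp add: power2_diff algebra_simps)
  qed
  define m where "m = Inf (J ` S)"
  have bdd: "bdd_below (J ` S)" using J_lower by (rule bdd_belowI2)
  have m_le: "m \<le> J f" if "f \<in> S" for f
    unfolding m_def using bdd that by (simp add: cINF_lower)
  have "\<exists>f\<in>S. J f < m + inverse (real (Suc n))" for n
  proof -
    have "Inf (J ` S) < m + inverse (real (Suc n))" by (simp add: m_def)
    then show ?thesis using cInf_lessD[of "J ` S"] S(2) by blast
  qed
  then obtain F where F: "\<And>n. F n \<in> S" "\<And>n. J (F n) < m + inverse (real (Suc n))"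
    by metis
  define d where "d n = J (F n) - m" for n
  have d: "0 \<le> d n" "d n < inverse (real (Suc n))" for n
    using F(2)[of n] m_le[OF F(1)[of n]] by (auto simp: d_def)
  have d_tendsto: "d \<longlonglongrightarrow> 0"
    by (rule tendsto_sandwich[OF _ _ tendsto_const LIMSEQ_inverse_real_of_nat])
      (auto intro!: always_eventually less_imp_le simp: d simp del: of_nat_Suc)
  let ?D = "\<lambda>f g. (\<lambda>t\<in>T. f t - g t)"
  \<comment> \<open>Parallelogram law: the squared distance equals
    \<open>2 * J (F i) + 2 * J (F j)\<close> minus four times \<open>J\<close> at the midpoint. The
    midpoint lies in \<open>S\<close>, so \<open>J\<close> is at least \<open>m\<close>
    there.\<close>
  have par: "Re (ip (?D (F i) (F j)) (?D (F i) (F j))) \<le> 2 * d i + 2 * d j" for i j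
  proof -
    note FS = F(1)[of i] F(1)[of j] and FH = SH[OF F(1)[of i]] SH[OF F(1)[of j]]
    let ?h = "lincomb (of_real (1/2)) (F i) (of_real (1/2)) (F j)"
    have 1: "m \<le> J ?h" using FS by (intro m_le S_lc)
    have 2: "J ?h = Re (ip (F i) (F i)) / 4 + Re (ip (F i) (F j)) / 2 + Re (ip (F j) (F j)) / 4
        - Re (l (F i)) - Re (l (F j))"
      unfolding J_def norm_lincomb[OF FH] l_lc[OF FS] by (simp add: power2_eq_square)
    have 3: "Re (ip (?D (F i) (F j)) (?D (F i) (F j))) =
        Re (ip (F i) (F i)) - 2 * Re (ip (F i) (F j)) + Re (ip (F j) (F j))"
      unfolding diff_eq_lincomb using norm_lincomb[OF FH, of 1 "-1"] by simp
    show ?thesis unfolding 3 using 1[unfolded 2] unfolding d_def J_def by (simp add: field_simps)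
  qed
  have "\<exists>k\<in>H. (\<lambda>n. sqrt (Re (ip (?D (F n) k) (?D (F n) k)))) \<longlonglongrightarrow> 0"
  proof (rule complete)
    show "F n \<in> H" for n using SH F by blast
    fix e :: real assume "e > 0"
    then have "\<forall>\<^sub>F n in sequentially. d n < e\<^sup>2 / 4"
      using d_tendsto by (intro order_tendstoD) auto
    then obtain N where N: "\<And>n. n \<ge> N \<Longrightarrow> d n < e\<^sup>2 / 4"
      by (auto simp: eventually_sequentially)
    have "sqrt (Re (ip (?D (F i) (F j)) (?D (F i) (F j)))) < e" if "i \<ge> N" "j \<ge> N" for i j
    proof -
      have "Re (ip (?D (F i) (F j)) (?D (F i) (F j))) < e\<^sup>2"
        using par[of i j] N[OF that(1)] N[OF that(2)] by linarith
      then have "sqrt (Re (ip (?D (F i) (F j)) (?D (F i) (F j)))) < sqrt (e\<^sup>2)"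
        by (rule real_sqrt_less_mono)
      then show ?thesis using \<open>e > 0\<close> by simp
    qed
    then show "\<exists>N. \<forall>i\<ge>N. \<forall>j\<ge>N. sqrt (Re (ip (?D (F i) (F j)) (?D (F i) (F j)))) < e" by blast
  qed
  then obtain k where k: "k \<in> H" and
    lim: "(\<lambda>n. sqrt (Re (ip (?D (F n) k) (?D (F n) k)))) \<longlonglongrightarrow> 0" by blast
  have Re_eq: "Re (ip h k) = Re (l h)" if h: "h \<in> S" for h
  proof -
    have hH: "h \<in> H" using SH h by blast
    have "(\<lambda>n. Re (ip (F n) h) - Re (ip k h)) \<longlonglongrightarrow> 0"
    proof (rule Lim_null_comparison)
      show "\<forall>\<^sub>F n in sequentially. norm (Re (ip (F n) h) - Re (ip k h)) \<le>
          sqrt (Re (ip (?D (F n) k) (?D (F n) k))) * sqrt (Re (ip h h))"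
      proof (intro always_eventually allI)
        fix n
        have FH: "F n \<in> H" using SH F by blast
        have "Re (ip (F n) h) - Re (ip k h) = Re (ip (?D (F n) k) h)"
          unfolding diff_eq_lincomb by (simp add: ip_lincomb_left FH k hH)
        then show "norm (Re (ip (F n) h) - Re (ip k h)) \<le>
          sqrt (Re (ip (?D (F n) k) (?D (F n) k))) * sqrt (Re (ip h h))"
          using Re_Cauchy_Schwarz[of "?D (F n) k" h] lincomb_mem[OF FH k] hH
          by (simp add: diff_eq_lincomb)
      qed
      show "(\<lambda>n. sqrt (Re (ip (?D (F n) k) (?D (F n) k))) * sqrt (Re (ip h h))) \<longlonglongrightarrow> 0"
        using tendsto_mult_left_zero[OF lim] by simp
    qed
    then have ip_lim: "(\<lambda>n. Re (ip (F n) h)) \<longlonglongrightarrow> Re (ip k h)" by (simp add: LIM_zero_iff)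
    \<comment> \<open>Near-minimality of \<open>F n\<close> makes \<open>J (F n + t * h) - m\<close>
      a nonnegative quadratic in \<open>t\<close> with constant term \<open>d n\<close>. In the
      limit the constant term vanishes, and so must the linear coefficient.\<close>
    have "(Re (ip k h) - Re (l h))\<^sup>2 \<le> 0 * Re (ip h h)"
    proof (rule nonneg_quadratic_discriminant)
      fix t :: real
      have "0 \<le> d n + 2 * t * (Re (ip (F n) h) - Re (l h)) + t\<^sup>2 * Re (ip h h)" for n
      proof -
        have "m \<le> J (lincomb (of_real 1) (F n) (of_real t) h)" using F h by (intro m_le S_lc)
        also have "\<dots> = J (F n) + 2 * t * (Re (ip (F n) h) - Re (l h)) + t\<^sup>2 * Re (ip h h)"
          unfolding J_def norm_lincomb[OF SH[OF F(1)] hH] l_lc[OF F(1) h]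
          by (simp add: algebra_simps)
        finally show ?thesis by (simp add: d_def)
      qed
      moreover have "(\<lambda>n. d n + 2 * t * (Re (ip (F n) h) - Re (l h)) + t\<^sup>2 * Re (ip h h))
          \<longlonglongrightarrow> 0 + 2 * t * (Re (ip k h) - Re (l h)) + t\<^sup>2 * Re (ip h h)"
        by (intro tendsto_intros d_tendsto ip_lim)
      ultimately show "0 \<le> 0 + 2 * t * (Re (ip k h) - Re (l h)) + t\<^sup>2 * Re (ip h h)"
        by (intro LIMSEQ_le_const) auto
    qed
    then show ?thesis using ip_cnj[OF hH k] by simp
  qed
  have "ip h k = l h" if h: "h \<in> S" for h
  proof -
    have hH: "h \<in> H" using SH h by blast
    \<comment> \<open>Multiplying by \<open>\<i>\<close> turns the identity of real parts into one
      of imaginary parts.\<close>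
    have "Re (ip (lincomb \<i> h 0 h) k) = Re (l (lincomb \<i> h 0 h))"
      using h by (intro Re_eq S_lc)
    then have "Im (ip h k) = Im (l h)"
      by (simp add: ip_lincomb_left hH k l_lc h)
    with Re_eq[OF h] show ?thesis by (simp add: complex_eq_iff)
  qed
  with k show ?thesis by blast
qed

end

section \<open>A kernel determines its space\<close>

lemma reproducing_kernel_left:
  assumes "function_hilbert_space T H ip" "has_reproducing_kernel T H ip K" "f \<in> H" "t \<in> T"
  shows "ip (\<lambda>s\<in>T. K s t) f = cnj (f t)"
  using assms function_hilbert_space.ip_cnj[OF assms(1), of f "\<lambda>s\<in>T. K s t"]
  by (simp add: has_reproducing_kernel_def)

text \<open>For \<open>f\<close> in the first space, \<open>\<langle>-, f\<rangle>\<close> is a bounded functional on the subspace where the two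
  inner products agree, which contains the kernel functions; representing it in the second space
  gives back \<open>f\<close> pointwise.\<close>

lemma reproducing_kernel_space_subset:
  assumes H1: "function_hilbert_space T H1 ip1" "has_reproducing_kernel T H1 ip1 K"
    and H2: "function_hilbert_space T H2 ip2" "has_reproducing_kernel T H2 ip2 K"
  shows "H1 \<subseteq> H2"
proof
  fix f assume f: "f \<in> H1"
  interpret h1: function_hilbert_space T H1 ip1 by fact
  interpret h2: function_hilbert_space T H2 ip2 by fact
  \<comment> \<open>Neither inclusion between the spaces is known yet. Testing against every
    \<open>g\<close> in the intersection keeps \<open>S\<close> linear; taking \<open>g = h\<close>
    makes the two norms agree on \<open>S\<close>.\<close>
  define S where "S = {h \<in> H1 \<inter> H2. \<forall>g\<in>H1 \<inter> H2. ip1 h g = ip2 h g}"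
  have K_S: "(\<lambda>s\<in>T. K s t) \<in> S" if t: "t \<in> T" for t
    using H1(2) H2(2) t reproducing_kernel_left[OF H1 _ t] reproducing_kernel_left[OF H2 _ t]
    by (simp add: S_def has_reproducing_kernel_def)
  have "\<exists>k\<in>H2. \<forall>h\<in>S. ip2 h k = ip1 h f"
  proof (rule h2.Riesz_subspace[where C = "sqrt (Re (ip1 f f))"])
    show "S \<subseteq> H2" by (auto simp: S_def)
    have "ip1 (\<lambda>t\<in>T. 0) g = 0" "ip2 (\<lambda>t\<in>T. 0) g = 0" if "g \<in> H1" "g \<in> H2" for g
      using h1.ip_scale[OF that(1,1), of 0] h2.ip_scale[OF that(2,2), of 0] by simp_all
    then have "(\<lambda>t\<in>T. 0) \<in> S" using h1.zero_mem h2.zero_mem by (simp add: S_def)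
    then show "S \<noteq> {}" by blast
  next
    fix a b h g assume "h \<in> S" "g \<in> S"
    then show "(\<lambda>t\<in>T. a * h t + b * g t) \<in> S"
      using h1.lincomb_mem[of h g a b] h2.lincomb_mem[of h g a b]
      unfolding h1.lincomb_def[symmetric] S_def
      by (simp add: h1.ip_lincomb_left h2.ip_lincomb_left)
  next
    fix a b h g assume "h \<in> S" "g \<in> S"
    then show "ip1 (\<lambda>t\<in>T. a * h t + b * g t) f = a * ip1 h f + b * ip1 g f"
      unfolding h1.lincomb_def[symmetric] S_def by (simp add: h1.ip_lincomb_left f)
  next
    fix h assume h: "h \<in> S"
    then have "ip1 h h = ip2 h h" by (simp add: S_def)
    \<comment> \<open>Cauchy-Schwarz in the first space bounds the functional by a norm that, on
      \<open>S\<close>, is also the norm of the second space.\<close>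
    then show "Re (ip1 h f) \<le> sqrt (Re (ip1 f f)) * sqrt (Re (ip2 h h))"
      using h1.Re_Cauchy_Schwarz[of h f] h f by (simp add: S_def mult.commute)
  qed
  then obtain k where k: "k \<in> H2" "\<And>h. h \<in> S \<Longrightarrow> ip2 h k = ip1 h f" by blast
  \<comment> \<open>On the kernel function at \<open>t\<close> both sides of the representation are
    conjugates of values at \<open>t\<close>; off \<open>T\<close> both functions are
    \<open>undefined\<close>.\<close>
  have "f t = k t" for t
  proof (cases "t \<in> T")
    case True
    then show ?thesis
      using k(2)[OF K_S[OF True]] reproducing_kernel_left[OF H1 f True]
        reproducing_kernel_left[OF H2 k(1) True] by simp
  next
    case False
    then show ?thesis using h1.carrier h2.carrier f k(1)
      by (metis extensional_arb subset_iff)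
  qed
  then have "f = k" by blast
  with k(1) show "f \<in> H2" by simp
qed

lemma rkhs_eqI:
  assumes "function_hilbert_space T H ip" "has_reproducing_kernel T H ip K"
  shows "rkhs T K = H"
  unfolding rkhs_def
proof (rule the_equality)
  show "\<exists>ip. function_hilbert_space T H ip \<and> has_reproducing_kernel T H ip K"
    using assms by blast
next
  fix H' assume "\<exists>ip. function_hilbert_space T H' ip \<and> has_reproducing_kernel T H' ip K"
  then show "H' = H" using assms reproducing_kernel_space_subset by (metis subset_antisym)
qed

section \<open>Completeness of L2\<close>

lemma borel_measurable_cnj [measurable (raw)]:
  "f \<in> borel_measurable M \<Longrightarrow> (\<lambda>x. cnj (f x)) \<in> borel_measurable M"
  by (rule borel_measurable_continuous_on[OF continuous_on_cnj[OF continuous_on_id]])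

lemma L2_spaceD:
  assumes "f \<in> L2_space M"
  shows "f \<in> borel_measurable M" "integrable M (\<lambda>x. (cmod (f x))\<^sup>2)"
  using assms by (auto simp: L2_space_def)

lemma L2_lincomb:
  assumes "f \<in> L2_space M" "g \<in> L2_space M"
  shows "(\<lambda>x. a * f x + b * g x) \<in> L2_space M"
proof -
  note [measurable] = assms[THEN L2_spaceD(1)]
  have bound: "(cmod (a * z + b * w))\<^sup>2 \<le> 2 * (cmod a)\<^sup>2 * (cmod z)\<^sup>2 + 2 * (cmod b)\<^sup>2 * (cmod w)\<^sup>2"
    for z w
  proof -
    have "(cmod (a * z + b * w))\<^sup>2 \<le> (cmod a * cmod z + cmod b * cmod w)\<^sup>2"
      by (metis norm_ge_zero norm_mult norm_triangle_ineq power_mono)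
    also have "\<dots> \<le> 2 * (cmod a * cmod z)\<^sup>2 + 2 * (cmod b * cmod w)\<^sup>2"
      by (smt (verit) power2_diff power2_sum zero_le_power2)
    finally show ?thesis by (simp add: power_mult_distrib)
  qed
  have "integrable M (\<lambda>x. (cmod (a * f x + b * g x))\<^sup>2)"
  proof (rule Bochner_Integration.integrable_bound)
    show "integrable M (\<lambda>x. 2 * (cmod a)\<^sup>2 * (cmod (f x))\<^sup>2 + 2 * (cmod b)\<^sup>2 * (cmod (g x))\<^sup>2)"
      using assms[THEN L2_spaceD(2)] by simp
    show "AE x in M. norm ((cmod (a * f x + b * g x))\<^sup>2)
        \<le> norm (2 * (cmod a)\<^sup>2 * (cmod (f x))\<^sup>2 + 2 * (cmod b)\<^sup>2 * (cmod (g x))\<^sup>2)"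
      using order_trans[OF bound abs_ge_self] by (intro always_eventually allI) simp
  qed simp
  then show ?thesis by (simp add: L2_space_def)
qed

lemma L2_zero: "(\<lambda>x. 0) \<in> L2_space M"
  by (simp add: L2_space_def)

lemma L2_scale: "f \<in> L2_space M \<Longrightarrow> (\<lambda>x. a * f x) \<in> L2_space M"
  using L2_lincomb[of f M f a 0] by simp

lemma L2_add: "f \<in> L2_space M \<Longrightarrow> g \<in> L2_space M \<Longrightarrow> (\<lambda>x. f x + g x) \<in> L2_space M"
  using L2_lincomb[of f M g 1 1] by simp

lemma L2_diff: "f \<in> L2_space M \<Longrightarrow> g \<in> L2_space M \<Longrightarrow> (\<lambda>x. f x - g x) \<in> L2_space M"
  using L2_lincomb[of f M g 1 "-1"] by simp

lemma L2_inner_integrable: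
  assumes "f \<in> L2_space M" "g \<in> L2_space M"
  shows "integrable M (\<lambda>x. f x * cnj (g x))"
proof (rule Bochner_Integration.integrable_bound)
  note [measurable] = assms[THEN L2_spaceD(1)]
  show "(\<lambda>x. f x * cnj (g x)) \<in> borel_measurable M" by simp
  show "integrable M (\<lambda>x. (cmod (f x))\<^sup>2 + (cmod (g x))\<^sup>2)"
    using assms[THEN L2_spaceD(2)] by simp
  show "AE x in M. norm (f x * cnj (g x)) \<le> norm ((cmod (f x))\<^sup>2 + (cmod (g x))\<^sup>2)"
  proof (intro always_eventually allI)
    fix x
    have "0 \<le> (cmod (f x) - cmod (g x))\<^sup>2" "0 \<le> cmod (f x) * cmod (g x)" by simp_all
    then have "cmod (f x) * cmod (g x) \<le> (cmod (f x))\<^sup>2 + (cmod (g x))\<^sup>2"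
      unfolding power2_diff by linarith
    then show "norm (f x * cnj (g x)) \<le> norm ((cmod (f x))\<^sup>2 + (cmod (g x))\<^sup>2)"
      by (simp add: norm_mult)
  qed
qed

lemma L2_inner_lincomb_left:
  assumes "f \<in> L2_space M" "g \<in> L2_space M" "k \<in> L2_space M"
  shows "L2_inner M (\<lambda>x. a * f x + b * g x) k = a * L2_inner M f k + b * L2_inner M g k"
  using L2_inner_integrable[OF assms(1,3)] L2_inner_integrable[OF assms(2,3)]
  by (simp add: L2_inner_def ring_distribs mult.assoc)

lemma L2_inner_cnj: "cnj (L2_inner M f g) = L2_inner M g f"
proof -
  have "cnj (\<integral>x. f x * cnj (g x) \<partial>M) = (\<integral>x. cnj (f x * cnj (g x)) \<partial>M)"
    by (rule Bochner_Integration.integral_cnj[symmetric])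
  then show ?thesis by (simp add: L2_inner_def mult.commute)
qed

lemma L2_inner_cong_AE:
  assumes "f \<in> L2_space M" "g \<in> L2_space M" "f' \<in> L2_space M" "g' \<in> L2_space M"
    and "AE x in M. f x = f' x" "AE x in M. g x = g' x"
  shows "L2_inner M f g = L2_inner M f' g'"
proof -
  note [measurable] = assms(1-4)[THEN L2_spaceD(1)]
  show ?thesis unfolding L2_inner_def
    using assms(5,6) by (intro integral_cong_AE) auto
qed

lemma L2_inner_self: "L2_inner M f f = of_real ((L2_norm M f)\<^sup>2)"
  unfolding L2_inner_def L2_norm_def complex_norm_square[symmetric] of_real_power
  by (simp flip: of_real_power)

lemma L2_norm_nonneg: "0 \<le> L2_norm M f"
  by (simp add: L2_norm_def)

lemma L2_norm_cong_AE:
  assumes "f \<in> L2_space M" "g \<in> L2_space M" "AE x in M. f x = g x"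
  shows "L2_norm M f = L2_norm M g"
proof -
  note [measurable] = assms(1,2)[THEN L2_spaceD(1)]
  show ?thesis unfolding L2_norm_def
    using assms(3) by (intro arg_cong[of _ _ sqrt] integral_cong_AE) auto
qed

lemma L2_norm_scale: "L2_norm M (\<lambda>x. a * f x) = cmod a * L2_norm M f"
  by (simp add: L2_norm_def norm_mult power_mult_distrib real_sqrt_mult)

lemma L2_norm_eq_0_iff:
  assumes "f \<in> L2_space M"
  shows "L2_norm M f = 0 \<longleftrightarrow> (AE x in M. f x = 0)"
  using integral_nonneg_eq_0_iff_AE[OF L2_spaceD(2)[OF assms]] by (simp add: L2_norm_def)

text \<open>The squared norm of \<open>f + t * g\<close> is a nonnegative quadratic in real
  \<open>t\<close>. The version for \<open>function_hilbert_space\<close> does not apply, since a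
  representative of norm zero may be nonzero on a null set.\<close>

lemma L2_Re_Cauchy_Schwarz:
  assumes "f \<in> L2_space M" "g \<in> L2_space M"
  shows "Re (L2_inner M f g) \<le> L2_norm M f * L2_norm M g"
proof -
  have "(Re (L2_inner M f g))\<^sup>2 \<le> (L2_norm M f)\<^sup>2 * (L2_norm M g)\<^sup>2"
  proof (rule nonneg_quadratic_discriminant)
    fix t :: real
    let ?h = "\<lambda>x. 1 * f x + of_real t * g x"
    have h: "?h \<in> L2_space M" using assms by (rule L2_lincomb)
    have "L2_inner M f ?h = cnj (L2_inner M ?h f)" "L2_inner M g ?h = cnj (L2_inner M ?h g)"
      by (simp_all add: L2_inner_cnj)
    then have "L2_inner M ?h ?h = L2_inner M f f + of_real t * (L2_inner M f g + L2_inner M g f)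
        + of_real (t\<^sup>2) * L2_inner M g g"
      unfolding L2_inner_lincomb_left[OF assms h]
      unfolding L2_inner_lincomb_left[OF assms assms(1)] L2_inner_lincomb_left[OF assms assms(2)]
      by (simp add: L2_inner_cnj algebra_simps power2_eq_square)
    then have "Re (L2_inner M ?h ?h) = (L2_norm M f)\<^sup>2 + 2 * t * Re (L2_inner M f g)
        + t\<^sup>2 * (L2_norm M g)\<^sup>2"
      unfolding L2_inner_self L2_inner_cnj[of M f g, symmetric] by simp
    moreover have "0 \<le> Re (L2_inner M ?h ?h)" unfolding L2_inner_self by simp
    ultimately show "0 \<le> (L2_norm M f)\<^sup>2 + 2 * t * Re (L2_inner M f g) + t\<^sup>2 * (L2_norm M g)\<^sup>2"
      by simp
  qed
  then have "(Re (L2_inner M f g))\<^sup>2 \<le> (L2_norm M f * L2_norm M g)\<^sup>2"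
    by (simp add: power_mult_distrib)
  then show ?thesis by (rule power2_le_imp_le) (simp add: L2_norm_nonneg)
qed

section \<open>Square-integrable functions are determined by integrals over sets of finite
  measure\<close>

lemma L2_indicator: "A \<in> fin_sets M \<Longrightarrow> indicator A \<in> L2_space M"
proof -
  assume A: "A \<in> fin_sets M"
  have "(\<lambda>x. (cmod (indicator A x))\<^sup>2) = (indicator A :: _ \<Rightarrow> real)"
    by (auto simp: indicator_def)
  then show ?thesis using A by (auto simp: L2_space_def fin_sets_def)
qed

lemma set_integral_eq_L2_inner: "(LINT x:A|M. h x) = L2_inner M h (indicator A)"
  unfolding set_lebesgue_integral_def L2_inner_def
  by (intro Bochner_Integration.integral_cong) (auto simp: indicator_def)

text \<open>The set where \<open>u\<close> exceeds a positive \<open>c\<close> has finite measure by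
  Markov's inequality for the square of \<open>u\<close>, so it is an admissible test set. The
  integral of \<open>u\<close> over it is zero although \<open>u > c\<close> there, so the set is
  null. Let \<open>c\<close> run through \<open>1 / (n + 1)\<close>.\<close>

lemma AE_nonpos_if_set_integrals_zero:
  fixes u :: "'a \<Rightarrow> real"
  assumes u[measurable]: "u \<in> borel_measurable M" and int: "integrable M (\<lambda>x. (u x)\<^sup>2)"
    and set_int: "\<And>A. A \<in> fin_sets M \<Longrightarrow> integrable M (\<lambda>x. indicator A x * u x)"
    and zero: "\<And>A. A \<in> fin_sets M \<Longrightarrow> (\<integral>x. indicator A x * u x \<partial>M) = 0"
  shows "AE x in M. u x \<le> 0"
proof -
  have "AE x in M. u x \<le> inverse (real (Suc n))" for n
  proof -
    define c where "c = inverse (real (Suc n))"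
    have c: "c > 0" by (simp add: c_def)
    define A where "A = {x \<in> space M. c < u x}"
    have A[measurable]: "A \<in> sets M" by (simp add: A_def)
    have "emeasure M {x \<in> space M. (u x)\<^sup>2 \<ge> c\<^sup>2} \<le> ennreal (1 / c\<^sup>2 * (\<integral>x. (u x)\<^sup>2 \<partial>M))"
      using int c by (intro integral_Markov_inequality) auto
    moreover have "emeasure M A \<le> emeasure M {x \<in> space M. (u x)\<^sup>2 \<ge> c\<^sup>2}"
      using c by (intro emeasure_mono) (auto simp: A_def intro!: power_mono)
    ultimately have "emeasure M A \<le> ennreal (1 / c\<^sup>2 * (\<integral>x. (u x)\<^sup>2 \<partial>M))"
      by (rule order_trans[rotated])
    also have "\<dots> < \<infinity>" by simp
    finally have "emeasure M A < \<infinity>" .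
    then have fin: "A \<in> fin_sets M" by (simp add: fin_sets_def)
    have "AE x in M. indicator A x * u x = 0"
      using zero[OF fin] integral_nonneg_eq_0_iff_AE[OF set_int[OF fin]] c
      by (auto simp: A_def indicator_def)
    then show ?thesis unfolding c_def[symmetric] using AE_space
    proof eventually_elim
      case (elim x)
      then show ?case using c by (auto simp: A_def indicator_def split: if_splits)
    qed
  qed
  then have "AE x in M. \<forall>n. u x \<le> inverse (real (Suc n))" by (simp add: AE_all_countable)
  then show ?thesis
  proof eventually_elim
    case (elim x)
    then show ?case using LIMSEQ_le_const[OF LIMSEQ_inverse_real_of_nat] by blast
  qed
qed

text \<open>The one-sided estimate, applied to the real parts of \<open>h\<close> times 1, -1,
  \<open>\<i>\<close> and \<open>-\<i>\<close>, bounds the real and imaginary parts of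
  \<open>h\<close> from both sides.\<close>

lemma L2_AE_zero_if_set_integrals_zero:
  assumes h: "h \<in> L2_space M" and zero: "\<And>A. A \<in> fin_sets M \<Longrightarrow> (LINT x:A|M. h x) = 0"
  shows "AE x in M. h x = 0"
proof -
  note [measurable] = L2_spaceD(1)[OF h]
  have nonpos: "AE x in M. Re (c * h x) \<le> 0" for c
  proof (rule AE_nonpos_if_set_integrals_zero)
    show "integrable M (\<lambda>x. (Re (c * h x))\<^sup>2)"
    proof (rule Bochner_Integration.integrable_bound)
      show "integrable M (\<lambda>x. (cmod (c * h x))\<^sup>2)" by (rule L2_spaceD(2)[OF L2_scale[OF h]])
      show "AE x in M. norm ((Re (c * h x))\<^sup>2) \<le> norm ((cmod (c * h x))\<^sup>2)"
        by (intro always_eventually allI) (simp add: cmod_power2)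
    qed simp
    fix A assume A: "A \<in> fin_sets M"
    have "integrable M (\<lambda>x. h x * cnj (indicator A x))"
      by (intro L2_inner_integrable h L2_indicator A)
    then have I: "integrable M (\<lambda>x. c * (h x * cnj (indicator A x)))" by simp
    have eq: "indicator A x * Re (c * h x) = Re (c * (h x * cnj (indicator A x)))" for x
      by (auto simp: indicator_def)
    show "integrable M (\<lambda>x. indicator A x * Re (c * h x))"
      unfolding eq by (rule integrable_Re[OF I])
    have "(\<integral>x. c * (h x * cnj (indicator A x)) \<partial>M) = 0"
      using zero[OF A] by (simp add: set_integral_eq_L2_inner L2_inner_def)
    then show "(\<integral>x. indicator A x * Re (c * h x) \<partial>M) = 0"
      unfolding eq integral_Re[OF I] by (simp only: zero_complex.sel)
  qed simp
  show ?thesis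
    using nonpos[of 1] nonpos[of "-1"] nonpos[of \<i>] nonpos[of "-\<i>"]
    by eventually_elim (simp add: complex_eq_iff)
qed

text \<open>Riesz--Fischer: along a subsequence with increments of norm below \<open>2 ^ - k\<close>, the integral of
  \<open>\<Sum>k. 2 ^ k * \<bar>D k\<bar>\<^sup>2\<close> is finite, so almost everywhere the increments \<open>D k\<close> decay geometrically;
  Fatou's lemma identifies the pointwise limit as the limit in norm.\<close>

theorem L2_complete:
  assumes F: "\<And>n. F n \<in> L2_space M"
    and Cauchy: "\<And>e. 0 < e \<Longrightarrow>
      \<exists>N. \<forall>m\<ge>N. \<forall>n\<ge>N. L2_norm M (\<lambda>x. F m x - F n x) < e"
  shows "\<exists>f\<in>L2_space M. (\<lambda>n. L2_norm M (\<lambda>x. F n x - f x)) \<longlonglongrightarrow> 0"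
proof -
  have meas[measurable]: "F n \<in> borel_measurable M" for n using F by (rule L2_spaceD)
  have nn_eq: "(\<integral>\<^sup>+x. ennreal ((cmod (g x))\<^sup>2) \<partial>M) = ennreal ((L2_norm M g)\<^sup>2)"
    if "g \<in> L2_space M" for g
    using L2_spaceD(2)[OF that] by (simp add: L2_norm_def nn_integral_eq_integral)
  have "\<exists>N. \<forall>m\<ge>N. \<forall>n\<ge>N. L2_norm M (\<lambda>x. F m x - F n x) < (1/2) ^ k" for k
    by (rule Cauchy) simp
  then obtain N where N: "\<And>k m n. m \<ge> N k \<Longrightarrow> n \<ge> N k \<Longrightarrow> L2_norm M (\<lambda>x. F m x - F n x) < (1/2) ^ k"
    by metis
  \<comment> \<open>An explicit index dominating both \<open>N k\<close> and \<open>k\<close>: the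
    first controls the increments, the second sends \<open>r k\<close> to infinity.\<close>
  define r where "r k = k + (\<Sum>i\<le>k. N i)" for k
  have r: "N k \<le> r k" "N k \<le> r (Suc k)" "k \<le> r k" for k
    using member_le_sum[of k "{..k}" N] by (auto simp: r_def)
  define D where "D k x = F (r (Suc k)) x - F (r k) x" for k x
  have D_L2: "D k \<in> L2_space M" for k unfolding D_def by (intro L2_diff F)
  have [measurable]: "D k \<in> borel_measurable M" for k using D_L2 by (rule L2_spaceD)
  \<comment> \<open>The squared norm of \<open>D k\<close> is at most \<open>(1/4) ^ k\<close>; the
    weight \<open>2 ^ k\<close> uses up half of the exponent and leaves a summable bound.\<close>
  have D_le: "(\<integral>\<^sup>+x. ennreal (2 ^ k * (cmod (D k x))\<^sup>2) \<partial>M) \<le> ennreal ((1/2) ^ k)" for k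
  proof -
    have "L2_norm M (D k) \<le> (1/2) ^ k" unfolding D_def using N r by (meson less_imp_le)
    then have "(L2_norm M (D k))\<^sup>2 \<le> ((1/2) ^ k)\<^sup>2" by (intro power_mono) (auto simp: L2_norm_nonneg)
    then have "2 ^ k * (L2_norm M (D k))\<^sup>2 \<le> 2 ^ k * ((1/2) ^ k)\<^sup>2" by simp
    also have "\<dots> = (1/2) ^ k" by (simp add: power2_eq_square power_divide)
    finally have le: "2 ^ k * (L2_norm M (D k))\<^sup>2 \<le> (1/2) ^ k" .
    have "(\<integral>\<^sup>+x. ennreal (2 ^ k * (cmod (D k x))\<^sup>2) \<partial>M)
        = ennreal (2 ^ k) * (\<integral>\<^sup>+x. ennreal ((cmod (D k x))\<^sup>2) \<partial>M)"
      by (simp add: ennreal_mult' nn_integral_cmult)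
    also have "\<dots> = ennreal (2 ^ k * (L2_norm M (D k))\<^sup>2)"
      by (simp add: nn_eq[OF D_L2] ennreal_mult')
    finally show ?thesis using le by (simp add: ennreal_leI)
  qed
  have "(\<integral>\<^sup>+x. (\<Sum>k. ennreal (2 ^ k * (cmod (D k x))\<^sup>2)) \<partial>M)
      = (\<Sum>k. \<integral>\<^sup>+x. ennreal (2 ^ k * (cmod (D k x))\<^sup>2) \<partial>M)"
    by (rule nn_integral_suminf) simp
  also have "\<dots> \<le> (\<Sum>k. ennreal ((1/2) ^ k))"
    by (intro suminf_le D_le) auto
  also have "\<dots> = ennreal (\<Sum>k. (1/2) ^ k)"
    by (intro suminf_ennreal2) (auto intro: summable_geometric)
  also have "\<dots> < \<infinity>" by simp
  finally have "(\<integral>\<^sup>+x. (\<Sum>k. ennreal (2 ^ k * (cmod (D k x))\<^sup>2)) \<partial>M) \<noteq> \<infinity>" by simp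
  then have "AE x in M. (\<Sum>k. ennreal (2 ^ k * (cmod (D k x))\<^sup>2)) \<noteq> \<infinity>"
    by (intro nn_integral_PInf_AE) auto
  then have lim_AE: "AE x in M. (\<lambda>k. F (r k) x) \<longlonglongrightarrow> lim (\<lambda>k. F (r k) x)"
  proof eventually_elim
    case (elim x)
    then have "summable (\<lambda>k. 2 ^ k * (cmod (D k x))\<^sup>2)"
      by (intro summable_suminf_not_top) auto
    then have "(\<lambda>k. 2 ^ k * (cmod (D k x))\<^sup>2) \<longlonglongrightarrow> 0" by (rule summable_LIMSEQ_zero)
    \<comment> \<open>Terms below 1 mean a squared modulus below \<open>(1/2) ^ k\<close>, hence the
      ratio \<open>sqrt (1/2)\<close>.\<close>
    then have "\<forall>\<^sub>F k in sequentially. 2 ^ k * (cmod (D k x))\<^sup>2 < 1"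
      by (rule order_tendstoD) simp
    then have "\<forall>\<^sub>F k in sequentially. norm (D k x) \<le> (sqrt (1/2)) ^ k"
    proof eventually_elim
      case (elim k)
      then have "(cmod (D k x))\<^sup>2 \<le> (1/2) ^ k" by (simp add: field_simps)
      also have "\<dots> = ((sqrt (1/2)) ^ k)\<^sup>2"
        by (simp only: power_mult[symmetric] mult.commute[of k 2]) (simp add: power_mult)
      finally show ?case by (rule power2_le_imp_le) simp
    qed
    moreover have "summable (\<lambda>k. (sqrt (1/2)) ^ k)"
      by (rule summable_geometric) (simp add: real_sqrt_divide)
    ultimately have "summable (\<lambda>k. D k x)" by (rule summable_comparison_test_ev)
    then have "(\<lambda>k. \<Sum>i<k. D i x) \<longlonglongrightarrow> (\<Sum>i. D i x)" by (rule summable_LIMSEQ)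
    moreover have "(\<Sum>i<k. D i x) = F (r k) x - F (r 0) x" for k
      unfolding D_def by (rule sum_lessThan_telescope)
    ultimately have "(\<lambda>k. F (r k) x - F (r 0) x + F (r 0) x) \<longlonglongrightarrow> (\<Sum>i. D i x) + F (r 0) x"
      by (intro tendsto_add) auto
    then show ?case by (auto simp: convergent_LIMSEQ_iff[symmetric] convergent_def)
  qed
  define f where "f x = lim (\<lambda>k. F (r k) x)" for x
  have [measurable]: "f \<in> borel_measurable M"
    unfolding f_def by (intro borel_measurable_lim_metric) simp
  \<comment> \<open>Stated with the nonnegative integral because \<open>f\<close> is not yet known
    to be square integrable; both that fact and the convergence follow from this bound.\<close>
  have Fatou: "(\<integral>\<^sup>+x. ennreal ((cmod (F n x - f x))\<^sup>2) \<partial>M) \<le> ennreal (e\<^sup>2)"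
    if "e > 0" and N': "\<And>i j. i \<ge> N' \<Longrightarrow> j \<ge> N' \<Longrightarrow> L2_norm M (\<lambda>x. F i x - F j x) < e" and "n \<ge> N'"
    for n e N'
  proof -
    have "(\<integral>\<^sup>+x. ennreal ((cmod (F n x - f x))\<^sup>2) \<partial>M)
        = (\<integral>\<^sup>+x. liminf (\<lambda>k. ennreal ((cmod (F n x - F (r k) x))\<^sup>2)) \<partial>M)"
    proof (rule nn_integral_cong_AE)
      show "AE x in M. ennreal ((cmod (F n x - f x))\<^sup>2)
          = liminf (\<lambda>k. ennreal ((cmod (F n x - F (r k) x))\<^sup>2))"
        using lim_AE
      proof eventually_elim
        case (elim x)
        then have "(\<lambda>k. ennreal ((cmod (F n x - F (r k) x))\<^sup>2))
            \<longlonglongrightarrow> ennreal ((cmod (F n x - f x))\<^sup>2)"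
          unfolding f_def by (intro tendsto_intros)
        then show ?case by (intro lim_imp_Liminf[symmetric]) auto
      qed
    qed
    also have "\<dots> \<le> liminf (\<lambda>k. \<integral>\<^sup>+x. ennreal ((cmod (F n x - F (r k) x))\<^sup>2) \<partial>M)"
      by (rule nn_integral_liminf) simp
    also have "\<dots> \<le> liminf (\<lambda>k. ennreal (e\<^sup>2))"
    proof (rule Liminf_mono)
      show "\<forall>\<^sub>F k in sequentially.
          (\<integral>\<^sup>+x. ennreal ((cmod (F n x - F (r k) x))\<^sup>2) \<partial>M) \<le> ennreal (e\<^sup>2)"
        using eventually_ge_at_top[of N']
      proof eventually_elim
        case (elim k)
        then have "L2_norm M (\<lambda>x. F n x - F (r k) x) < e"
          using N' \<open>n \<ge> N'\<close> r(3)[of k] by (meson order_trans)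
        then have "(L2_norm M (\<lambda>x. F n x - F (r k) x))\<^sup>2 \<le> e\<^sup>2"
          by (intro power_mono) (auto simp: L2_norm_nonneg)
        then show ?case by (simp add: nn_eq[OF L2_diff[OF F F]] ennreal_leI)
      qed
    qed
    also have "\<dots> = ennreal (e\<^sup>2)" by (simp add: Liminf_const)
    finally show ?thesis .
  qed
  have diff_L2: "(\<lambda>x. F n x - f x) \<in> L2_space M"
    if "e > 0" "\<And>i j. i \<ge> N' \<Longrightarrow> j \<ge> N' \<Longrightarrow> L2_norm M (\<lambda>x. F i x - F j x) < e" "n \<ge> N'" for n e N'
  proof -
    have "(\<integral>\<^sup>+x. ennreal ((cmod (F n x - f x))\<^sup>2) \<partial>M) < \<infinity>"
      using Fatou[OF that] by (simp add: le_less_trans[OF _ ennreal_less_top])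
    then have "integrable M (\<lambda>x. (cmod (F n x - f x))\<^sup>2)"
      by (intro integrableI_nonneg) auto
    then show ?thesis by (simp add: L2_space_def)
  qed
  have f: "f \<in> L2_space M"
  proof -
    have "(\<lambda>x. F (N 0) x - f x) \<in> L2_space M" by (rule diff_L2[of 1 "N 0"]) (use N[of 0] in auto)
    then have "(\<lambda>x. F (N 0) x - (F (N 0) x - f x)) \<in> L2_space M" by (rule L2_diff[OF F])
    then show ?thesis by (simp add: diff_diff_eq2)
  qed
  have "(\<lambda>n. L2_norm M (\<lambda>x. F n x - f x)) \<longlonglongrightarrow> 0"
  proof (rule metric_LIMSEQ_I)
    fix e :: real assume "e > 0"
    \<comment> \<open>Half of \<open>e\<close>, since passing to the limit weakens the strict
      inequality.\<close>
    then have e2: "e / 2 > 0" by simp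
    then obtain N' where N': "\<And>i j. i \<ge> N' \<Longrightarrow> j \<ge> N' \<Longrightarrow> L2_norm M (\<lambda>x. F i x - F j x) < e / 2"
      using Cauchy by metis
    have "L2_norm M (\<lambda>x. F n x - f x) < e" if "n \<ge> N'" for n
    proof -
      have "ennreal ((L2_norm M (\<lambda>x. F n x - f x))\<^sup>2) \<le> ennreal ((e/2)\<^sup>2)"
        using Fatou[OF e2 N' that] nn_eq[OF L2_diff[OF F f], of n] by simp
      then have "(L2_norm M (\<lambda>x. F n x - f x))\<^sup>2 \<le> (e/2)\<^sup>2" by simp
      then have "L2_norm M (\<lambda>x. F n x - f x) \<le> e / 2"
        using e2 by (rule power2_le_imp_le[OF _ less_imp_le])
      then show ?thesis using \<open>e > 0\<close> by linarith
    qed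
    then show "\<exists>N'. \<forall>n\<ge>N'. dist (L2_norm M (\<lambda>x. F n x - f x)) 0 < e"
      by (auto simp: L2_norm_nonneg)
  qed
  with f show ?thesis by blast
qed

section \<open>Set functions with square-integrable density\<close>

text \<open>The inverse of the Krein-Feller derivative, up to null sets. The restriction matches the
  \<open>extensional\<close> carrier of \<open>function_hilbert_space\<close>.\<close>

definition set_integral_function :: "'a measure \<Rightarrow> ('a \<Rightarrow> complex) \<Rightarrow> 'a set \<Rightarrow> complex" where
  "set_integral_function M h = (\<lambda>A\<in>fin_sets M. LINT x:A|M. h x)"

lemma set_integral_function_apply:
  "A \<in> fin_sets M \<Longrightarrow> set_integral_function M h A = L2_inner M h (indicator A)"
  by (simp add: set_integral_function_def set_integral_eq_L2_inner)

lemma set_integral_function_lincomb: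
  assumes "h \<in> L2_space M" "k \<in> L2_space M"
  shows "set_integral_function M (\<lambda>x. a * h x + b * k x) =
    (\<lambda>A\<in>fin_sets M. a * set_integral_function M h A + b * set_integral_function M k A)"
proof
  fix A
  show "set_integral_function M (\<lambda>x. a * h x + b * k x) A =
    (\<lambda>A\<in>fin_sets M. a * set_integral_function M h A + b * set_integral_function M k A) A"
  proof (cases "A \<in> fin_sets M")
    case True
    then show ?thesis
      by (simp add: set_integral_function_apply L2_inner_lincomb_left assms L2_indicator)
  qed (simp add: set_integral_function_def)
qed

lemma set_integral_function_eq_iff:
  assumes h: "h \<in> L2_space M" and k: "k \<in> L2_space M"
  shows "set_integral_function M h = set_integral_function M k \<longleftrightarrow> (AE x in M. h x = k x)"
proof
  assume eq: "set_integral_function M h = set_integral_function M k"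
  have "AE x in M. 1 * h x + - 1 * k x = 0"
  proof (rule L2_AE_zero_if_set_integrals_zero)
    show "(\<lambda>x. 1 * h x + - 1 * k x) \<in> L2_space M" using h k by (rule L2_lincomb)
    fix A assume A: "A \<in> fin_sets M"
    then show "(LINT x:A|M. 1 * h x + - 1 * k x) = 0"
      unfolding set_integral_eq_L2_inner L2_inner_lincomb_left[OF h k L2_indicator[OF A]]
      using fun_cong[OF eq, of A] by (simp add: set_integral_function_apply)
  qed
  then show "AE x in M. h x = k x" by simp
next
  assume AE: "AE x in M. h x = k x"
  show "set_integral_function M h = set_integral_function M k"
    unfolding set_integral_function_def set_integral_eq_L2_inner
    by (intro restrict_ext L2_inner_cong_AE h k L2_indicator AE) auto
qed

text \<open>\<open>SOME\<close> may pick another density than \<open>h\<close>, but both have the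
  same integrals over sets of finite measure, so they differ only on a null set.\<close>

lemma krein_feller_set_integral_function:
  assumes h: "h \<in> L2_space M"
  shows "krein_feller M (set_integral_function M h) \<in> L2_space M"
    and "AE x in M. krein_feller M (set_integral_function M h) x = h x"
proof -
  let ?k = "krein_feller M (set_integral_function M h)"
  have "\<exists>k. k \<in> L2_space M \<and> (\<forall>A\<in>fin_sets M. set_integral_function M h A = (LINT x:A|M. k x))"
    using h by (intro exI[of _ h]) (simp add: set_integral_function_def)
  then have "?k \<in> L2_space M \<and> (\<forall>A\<in>fin_sets M. set_integral_function M h A = (LINT x:A|M. ?k x))"
    unfolding krein_feller_def by (rule someI_ex)
  then have k: "?k \<in> L2_space M" "\<And>A. A \<in> fin_sets M \<Longrightarrow> set_integral_function M h A = (LINT x:A|M. ?k x)"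
    by auto
  show "?k \<in> L2_space M" by (rule k(1))
  have "set_integral_function M ?k = set_integral_function M h"
    using k(2) by (auto simp: set_integral_function_def fun_eq_iff restrict_def)
  then show "AE x in M. ?k x = h x"
    using set_integral_function_eq_iff[OF k(1) h] by blast
qed

text \<open>The L2 inner product transported to set functions; on those with a density in L2 the
  chosen representatives do not affect the value.\<close>

definition measure_rkhs_inner :: "'a measure \<Rightarrow> ('a set \<Rightarrow> complex) \<Rightarrow> ('a set \<Rightarrow> complex) \<Rightarrow> complex" where
  "measure_rkhs_inner M f g = L2_inner M (krein_feller M f) (krein_feller M g)"

lemma measure_rkhs_inner_set_integral_function:
  assumes "h \<in> L2_space M" "k \<in> L2_space M"
  shows "measure_rkhs_inner M (set_integral_function M h) (set_integral_function M k) = L2_inner M h k"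
  unfolding measure_rkhs_inner_def
  by (intro L2_inner_cong_AE krein_feller_set_integral_function assms)

text \<open>Every axiom is pulled back to densities: definiteness becomes injectivity modulo null
  sets, completeness becomes that of L2.\<close>

lemma function_hilbert_space_set_integral_function:
  "function_hilbert_space (fin_sets M) (set_integral_function M ` L2_space M) (measure_rkhs_inner M)"
proof -
  let ?T = "fin_sets M" and ?I = "set_integral_function M" and ?ip = "measure_rkhs_inner M"
  note ip = measure_rkhs_inner_set_integral_function
  have add: "(\<lambda>A\<in>?T. ?I h A + ?I k A) = ?I (\<lambda>x. h x + k x)"
    if "h \<in> L2_space M" "k \<in> L2_space M" for h k
    using set_integral_function_lincomb[OF that, of 1 1] by simp
  have diff: "(\<lambda>A\<in>?T. ?I h A - ?I k A) = ?I (\<lambda>x. h x - k x)"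
    if "h \<in> L2_space M" "k \<in> L2_space M" for h k
    using set_integral_function_lincomb[OF that, of 1 "-1"] by simp
  have scale: "(\<lambda>A\<in>?T. a * ?I h A) = ?I (\<lambda>x. a * h x)" if "h \<in> L2_space M" for h a
    using set_integral_function_lincomb[OF that that, of a 0] by simp
  have zero: "(\<lambda>A\<in>?T. 0) = ?I (\<lambda>x. 0)"
    using scale[OF L2_zero, of 0] by simp
  have norm: "sqrt (Re (?ip (?I h) (?I h))) = L2_norm M h" if "h \<in> L2_space M" for h
    using that by (simp add: ip L2_inner_self L2_norm_nonneg)
  show ?thesis
  proof
    show "?I ` L2_space M \<subseteq> extensional ?T" by (auto simp: set_integral_function_def)
    show "(\<lambda>A\<in>?T. 0) \<in> ?I ` L2_space M" unfolding zero by (intro imageI L2_zero)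
  next
    fix f g assume "f \<in> ?I ` L2_space M" "g \<in> ?I ` L2_space M"
    then show "(\<lambda>A\<in>?T. f A + g A) \<in> ?I ` L2_space M" by (auto simp: add L2_add)
  next
    fix f a assume "f \<in> ?I ` L2_space M"
    then show "(\<lambda>A\<in>?T. a * f A) \<in> ?I ` L2_space M" by (auto simp: scale L2_scale)
  next
    fix f g k assume "f \<in> ?I ` L2_space M" "g \<in> ?I ` L2_space M" "k \<in> ?I ` L2_space M"
    then show "?ip (\<lambda>A\<in>?T. f A + g A) k = ?ip f k + ?ip g k"
      using L2_inner_lincomb_left[of _ M _ _ 1 1] by (auto simp: add L2_add ip)
  next
    fix f g a assume "f \<in> ?I ` L2_space M" "g \<in> ?I ` L2_space M"
    then show "?ip (\<lambda>A\<in>?T. a * f A) g = a * ?ip f g"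
      using L2_inner_lincomb_left[of _ M _ _ a 0] by (auto simp: scale L2_scale ip)
  next
    fix f g show "?ip g f = cnj (?ip f g)"
      by (simp add: measure_rkhs_inner_def L2_inner_cnj)
  next
    fix f show "0 \<le> Re (?ip f f)"
      by (simp add: measure_rkhs_inner_def L2_inner_self)
  next
    fix f assume "f \<in> ?I ` L2_space M" "?ip f f = 0"
    then obtain h where h: "h \<in> L2_space M" "f = ?I h" "L2_norm M h = 0"
      by (auto simp: ip L2_inner_self)
    then show "f = (\<lambda>A\<in>?T. 0)"
      unfolding zero h(2) by (simp add: set_integral_function_eq_iff L2_zero L2_norm_eq_0_iff)
  next
    fix F :: "nat \<Rightarrow> 'a set \<Rightarrow> complex"
    assume "\<And>n. F n \<in> ?I ` L2_space M"
    then have "\<exists>h. h \<in> L2_space M \<and> F n = ?I h" for n by blast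
    then obtain h where h: "\<And>n. h n \<in> L2_space M" "\<And>n. F n = ?I (h n)" by metis
    assume "\<And>e. 0 < e \<Longrightarrow> \<exists>N. \<forall>m\<ge>N. \<forall>n\<ge>N.
      sqrt (Re (?ip (\<lambda>A\<in>?T. F m A - F n A) (\<lambda>A\<in>?T. F m A - F n A))) < e"
    then have "\<And>e. 0 < e \<Longrightarrow> \<exists>N. \<forall>m\<ge>N. \<forall>n\<ge>N. L2_norm M (\<lambda>x. h m x - h n x) < e"
      unfolding h(2) diff[OF h(1) h(1)] norm[OF L2_diff[OF h(1) h(1)]] .
    then have "\<exists>g\<in>L2_space M. (\<lambda>n. L2_norm M (\<lambda>x. h n x - g x)) \<longlonglongrightarrow> 0"
      by (rule L2_complete[OF h(1)])
    then obtain g where g: "g \<in> L2_space M" "(\<lambda>n. L2_norm M (\<lambda>x. h n x - g x)) \<longlonglongrightarrow> 0"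
      by (rule bexE)
    show "\<exists>f\<in>?I ` L2_space M.
      (\<lambda>n. sqrt (Re (?ip (\<lambda>A\<in>?T. F n A - f A) (\<lambda>A\<in>?T. F n A - f A)))) \<longlonglongrightarrow> 0"
      using g unfolding h(2)
      by (intro bexI[of _ "?I g"] imageI) (simp_all add: diff[OF h(1) g(1)] norm[OF L2_diff[OF h(1) g(1)]])
  qed
qed

text \<open>Identifies the density of the kernel function at \<open>B\<close>.\<close>

lemma set_integral_function_indicator:
  assumes "B \<in> fin_sets M"
  shows "set_integral_function M (indicator B) = (\<lambda>A\<in>fin_sets M. complex_of_real (measure M (A \<inter> B)))"
proof -
  have "L2_inner M (indicator B) (indicator A) = complex_of_real (measure M (A \<inter> B))"
    if A: "A \<in> fin_sets M" for A
  proof -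
    have "(\<lambda>x. indicator B x * cnj (indicator A x)) = (\<lambda>x. complex_of_real (indicator (A \<inter> B) x))"
      by (auto simp: indicator_def fun_eq_iff)
    moreover have "A \<inter> B \<inter> space M = A \<inter> B"
      using A sets.sets_into_space by (auto simp: fin_sets_def)
    ultimately show ?thesis by (simp add: L2_inner_def)
  qed
  then show ?thesis
    unfolding set_integral_function_def set_integral_eq_L2_inner by (intro restrict_ext)
qed

text \<open>The reproducing property holds because pairing a density with the indicator of
  \<open>B\<close> integrates it over \<open>B\<close>, which is evaluation of the set function at
  \<open>B\<close>.\<close>

theorem measure_rkhs_eq: "measure_rkhs M = set_integral_function M ` L2_space M"
  unfolding measure_rkhs_def
proof (rule rkhs_eqI)
  show "function_hilbert_space (fin_sets M) (set_integral_function M ` L2_space M) (measure_rkhs_inner M)"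
    by (rule function_hilbert_space_set_integral_function)
  show "has_reproducing_kernel (fin_sets M) (set_integral_function M ` L2_space M)
      (measure_rkhs_inner M) (\<lambda>A B. complex_of_real (measure M (A \<inter> B)))"
    unfolding has_reproducing_kernel_def
    by (auto simp: set_integral_function_indicator[symmetric] L2_indicator
        measure_rkhs_inner_set_integral_function set_integral_function_apply)
qed

section \<open>The adjoint of a continuous linear operator\<close>

lemma L2_linearD:
  assumes V: "L2_linear M N V" and f: "f \<in> L2_space M" and g: "g \<in> L2_space M"
  shows "AE y in N. V (\<lambda>x. a * f x + b * g x) y = a * V f y + b * V g y"
  by (rule bspec[OF bspec[OF V[unfolded L2_linear_def] f] g, THEN spec, THEN spec])

text \<open>Continuity at zero with tolerance 1 gives a radius \<open>d\<close>, and rescaling gives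
  the constant \<open>1 / d\<close>. Since linearity holds only almost everywhere, so does
  \<open>V 0 = 0\<close>.\<close>

lemma L2_continuous_linear_bounded:
  assumes V: "V \<in> L2_space M \<rightarrow> L2_space N" "L2_linear M N V" "L2_continuous M N V"
  obtains C where "\<And>f. f \<in> L2_space M \<Longrightarrow> L2_norm N (V f) \<le> C * L2_norm M f"
proof -
  have V_L2: "V f \<in> L2_space N" if "f \<in> L2_space M" for f using V(1) that by (rule funcset_mem)
  have V0: "AE y in N. V (\<lambda>x. 0) y = 0"
  proof -
    have "AE y in N. V (\<lambda>x. 0 * 0 + 0 * 0) y = 0 * V (\<lambda>x. 0) y + 0 * V (\<lambda>x. 0) y"
      using V(2) L2_zero L2_zero by (rule L2_linearD)
    then show ?thesis by simp
  qed
  have V_scale: "L2_norm N (V (\<lambda>x. a * f x)) = cmod a * L2_norm N (V f)" if f: "f \<in> L2_space M" for a f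
  proof -
    have "AE y in N. V (\<lambda>x. a * f x + 0 * f x) y = a * V f y + 0 * V f y"
      using V(2) f f by (rule L2_linearD)
    then have "L2_norm N (V (\<lambda>x. a * f x)) = L2_norm N (\<lambda>y. a * V f y)"
      using f by (intro L2_norm_cong_AE V_L2 L2_scale) auto
    then show ?thesis by (simp add: L2_norm_scale)
  qed
  obtain d where d: "d > 0" "\<And>g. g \<in> L2_space M \<Longrightarrow> L2_norm M (\<lambda>x. g x - 0) < d \<Longrightarrow>
      L2_norm N (\<lambda>y. V g y - V (\<lambda>x. 0) y) < 1"
    using bspec[OF V(3)[unfolded L2_continuous_def] L2_zero] zero_less_one by blast
  have small: "L2_norm N (V g) < 1" if g: "g \<in> L2_space M" "L2_norm M g < d" for g
  proof -
    have "L2_norm N (V g) = L2_norm N (\<lambda>y. V g y - V (\<lambda>x. 0) y)"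
      using V0 g by (intro L2_norm_cong_AE V_L2 L2_diff L2_zero) auto
    then show ?thesis using d(2)[of g] g by simp
  qed
  have "L2_norm N (V f) \<le> (1 / d) * L2_norm M f" if f: "f \<in> L2_space M" for f
  proof -
    \<comment> \<open>Rescaling by \<open>d / s\<close> with \<open>s\<close> above the norm of
      \<open>f\<close> avoids dividing by a norm that may be zero; then \<open>s\<close> decreases
      to the norm.\<close>
    have "L2_norm N (V f) * d \<le> s" if s: "L2_norm M f < s" for s
    proof -
      have "s > 0" using s L2_norm_nonneg[of M f] by linarith
      have "L2_norm N (V (\<lambda>x. of_real (d / s) * f x)) < 1"
      proof (intro small L2_scale f)
        show "L2_norm M (\<lambda>x. of_real (d / s) * f x) < d"
          unfolding L2_norm_scale norm_of_real using s d(1) \<open>s > 0\<close> by (simp add: field_simps)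
      qed
      then show ?thesis
        unfolding V_scale[OF f] norm_of_real using d(1) \<open>s > 0\<close> by (simp add: field_simps)
    qed
    then have "L2_norm N (V f) * d \<le> L2_norm M f" by (rule dense_ge)
    then show ?thesis using d(1) by (simp add: field_simps)
  qed
  then show ?thesis by (rule that)
qed

text \<open>The bound gives \<open>V (f - g)\<close> norm zero. This allows the density chosen by
  \<open>krein_feller\<close> to be replaced by any other under \<open>V\<close>.\<close>

lemma L2_continuous_linear_cong_AE:
  assumes V: "V \<in> L2_space M \<rightarrow> L2_space N" "L2_linear M N V" "L2_continuous M N V"
    and f: "f \<in> L2_space M" and g: "g \<in> L2_space M" and AE: "AE x in M. f x = g x"
  shows "AE y in N. V f y = V g y"
proof -
  obtain C where C: "\<And>f. f \<in> L2_space M \<Longrightarrow> L2_norm N (V f) \<le> C * L2_norm M f"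
    using L2_continuous_linear_bounded[OF V] by metis
  let ?d = "\<lambda>x. 1 * f x + - 1 * g x"
  have d: "?d \<in> L2_space M" using f g by (rule L2_lincomb)
  have "L2_norm M ?d = 0" using AE unfolding L2_norm_eq_0_iff[OF d] by simp
  then have "L2_norm N (V ?d) = 0" using C[OF d] L2_norm_nonneg[of N "V ?d"] by simp
  then have "AE y in N. V ?d y = 0" using L2_norm_eq_0_iff[OF funcset_mem[OF V(1) d]] by simp
  moreover have "AE y in N. V ?d y = 1 * V f y + - 1 * V g y"
    using V(2) f g by (rule L2_linearD)
  ultimately show ?thesis by eventually_elim simp
qed

section \<open>The adjoint of the Ito isometry\<close>

theorem corollary4p5:
  fixes \<mu> :: "'a measure" and P :: "'w measure"
    and W :: "'a set \<Rightarrow> 'w \<Rightarrow> real"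
    and V :: "('a \<Rightarrow> complex) \<Rightarrow> 'w \<Rightarrow> complex"
  assumes "sigma_finite_measure \<mu>"
    and "prob_space P"
    and "brownian_motion \<mu> P W"
    and "is_ito_isometry \<mu> P W V"
  shows "(\<forall>\<psi> \<in> L2_space P.
            (\<lambda>A\<in>fin_sets \<mu>. \<integral>\<omega>. \<psi> \<omega> * complex_of_real (W A \<omega>) \<partial>P) \<in> measure_rkhs \<mu>) \<and>
         is_L2_adjoint \<mu> P V
           (\<lambda>\<psi>. krein_feller \<mu>
             (\<lambda>A\<in>fin_sets \<mu>. \<integral>\<omega>. \<psi> \<omega> * complex_of_real (W A \<omega>) \<partial>P))"
proof -
  have V: "V \<in> L2_space \<mu> \<rightarrow> L2_space P" "L2_linear \<mu> P V" "L2_continuous \<mu> P V"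
    and V_ind: "\<And>A. A \<in> fin_sets \<mu> \<Longrightarrow> AE \<omega> in P. V (indicator A) \<omega> = complex_of_real (W A \<omega>)"
    using assms(4) by (auto simp: is_ito_isometry_def)
  have W: "(\<lambda>\<omega>. complex_of_real (W A \<omega>)) \<in> L2_space P" if "A \<in> fin_sets \<mu>" for A
    using assms(3) that by (simp add: brownian_motion_def)
  have V_L2: "V f \<in> L2_space P" if "f \<in> L2_space \<mu>" for f using V(1) that by (rule funcset_mem)
  obtain C where C: "\<And>f. f \<in> L2_space \<mu> \<Longrightarrow> L2_norm P (V f) \<le> C * L2_norm \<mu> f"
    using L2_continuous_linear_bounded[OF V] by metis
  let ?I = "set_integral_function \<mu>"
  interpret function_hilbert_space "fin_sets \<mu>" "?I ` L2_space \<mu>" "measure_rkhs_inner \<mu>"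
    by (rule function_hilbert_space_set_integral_function)
  have main: "\<exists>k\<in>L2_space \<mu>. ?I k = (\<lambda>A\<in>fin_sets \<mu>. \<integral>\<omega>. \<psi> \<omega> * complex_of_real (W A \<omega>) \<partial>P) \<and>
      (\<forall>h\<in>L2_space \<mu>. L2_inner P (V h) \<psi> = L2_inner \<mu> h k)"
    if \<psi>: "\<psi> \<in> L2_space P" for \<psi>
  proof -
    define l where "l M = L2_inner P (V (krein_feller \<mu> M)) \<psi>" for M
    have l: "l (?I h) = L2_inner P (V h) \<psi>" if h: "h \<in> L2_space \<mu>" for h
      unfolding l_def using krein_feller_set_integral_function[OF h] h
      by (intro L2_inner_cong_AE V_L2 \<psi> L2_continuous_linear_cong_AE[OF V]) auto
    have "\<exists>m\<in>?I ` L2_space \<mu>. \<forall>M\<in>?I ` L2_space \<mu>. measure_rkhs_inner \<mu> M m = l M"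
    \<comment> \<open>The subspace is the whole space here; the constant combines the bound for
      \<open>V\<close> with Cauchy-Schwarz against \<open>\<psi>\<close>.\<close>
    proof (rule Riesz_subspace[where C = "C * L2_norm P \<psi>"])
      show "?I ` L2_space \<mu> \<subseteq> ?I ` L2_space \<mu>" ..
      show "?I ` L2_space \<mu> \<noteq> {}" using L2_zero by blast
    next
      fix a b f g assume "f \<in> ?I ` L2_space \<mu>" "g \<in> ?I ` L2_space \<mu>"
      then show "(\<lambda>A\<in>fin_sets \<mu>. a * f A + b * g A) \<in> ?I ` L2_space \<mu>"
        by (auto simp: set_integral_function_lincomb[symmetric] L2_lincomb)
    next
      fix a b f g assume "f \<in> ?I ` L2_space \<mu>" "g \<in> ?I ` L2_space \<mu>"
      then obtain h k where h: "h \<in> L2_space \<mu>" "f = ?I h" and k: "k \<in> L2_space \<mu>" "g = ?I k" by blast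
      have "AE \<omega> in P. V (\<lambda>x. a * h x + b * k x) \<omega> = a * V h \<omega> + b * V k \<omega>"
        using V(2) h(1) k(1) by (rule L2_linearD)
      then have "L2_inner P (V (\<lambda>x. a * h x + b * k x)) \<psi> = L2_inner P (\<lambda>\<omega>. a * V h \<omega> + b * V k \<omega>) \<psi>"
        using h k by (intro L2_inner_cong_AE V_L2 \<psi> L2_lincomb) auto
      then show "l (\<lambda>A\<in>fin_sets \<mu>. a * f A + b * g A) = a * l f + b * l g"
        unfolding h(2) k(2) set_integral_function_lincomb[OF h(1) k(1), symmetric]
        using h(1) k(1) by (simp add: l L2_lincomb L2_inner_lincomb_left V_L2 \<psi>)
    next
      fix f assume "f \<in> ?I ` L2_space \<mu>"
      then obtain h where h: "h \<in> L2_space \<mu>" "f = ?I h" by blast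
      have "Re (l f) \<le> L2_norm P (V h) * L2_norm P \<psi>"
        unfolding h(2) l[OF h(1)] by (intro L2_Re_Cauchy_Schwarz V_L2 h \<psi>)
      also have "\<dots> \<le> (C * L2_norm \<mu> h) * L2_norm P \<psi>"
        by (intro mult_right_mono C h L2_norm_nonneg)
      finally show "Re (l f) \<le> C * L2_norm P \<psi> * sqrt (Re (measure_rkhs_inner \<mu> f f))"
        by (simp add: h measure_rkhs_inner_set_integral_function L2_inner_self L2_norm_nonneg mult_ac)
    qed
    then obtain k where k: "k \<in> L2_space \<mu>" "\<And>h. h \<in> L2_space \<mu> \<Longrightarrow> L2_inner \<mu> h k = L2_inner P (V h) \<psi>"
      by (auto simp: l measure_rkhs_inner_set_integral_function)
    have "?I k A = (\<lambda>A\<in>fin_sets \<mu>. \<integral>\<omega>. \<psi> \<omega> * complex_of_real (W A \<omega>) \<partial>P) A" for A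
    proof (cases "A \<in> fin_sets \<mu>")
      case A: True
      \<comment> \<open>The density \<open>k\<close> sits in the conjugate-linear slot, so the
        representation identity is conjugated; since \<open>W A\<close> is real, no conjugate
        survives in the expectation.\<close>
      have "?I k A = cnj (L2_inner \<mu> (indicator A) k)"
        by (simp add: set_integral_function_apply A L2_inner_cnj)
      also have "\<dots> = L2_inner P \<psi> (V (indicator A))"
        by (simp add: k(2) L2_indicator A L2_inner_cnj)
      also have "\<dots> = L2_inner P \<psi> (\<lambda>\<omega>. complex_of_real (W A \<omega>))"
        using A by (intro L2_inner_cong_AE \<psi> V_L2 W L2_indicator V_ind) auto
      finally show ?thesis using A by (simp add: L2_inner_def)
    qed (simp add: set_integral_function_def)
    with k show ?thesis by (intro bexI[of _ k]) auto
  qed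
  show ?thesis
  proof (intro conjI ballI)
    fix \<psi> assume "\<psi> \<in> L2_space P"
    then show "(\<lambda>A\<in>fin_sets \<mu>. \<integral>\<omega>. \<psi> \<omega> * complex_of_real (W A \<omega>) \<partial>P) \<in> measure_rkhs \<mu>"
      unfolding measure_rkhs_eq using main by (metis image_eqI)
  next
    show "is_L2_adjoint \<mu> P V
           (\<lambda>\<psi>. krein_feller \<mu>
             (\<lambda>A\<in>fin_sets \<mu>. \<integral>\<omega>. \<psi> \<omega> * complex_of_real (W A \<omega>) \<partial>P))"
      (is "is_L2_adjoint \<mu> P V (\<lambda>\<psi>. krein_feller \<mu> (?m \<psi>))")
      unfolding is_L2_adjoint_def
    proof (intro conjI Pi_I ballI)
      fix \<psi> assume "\<psi> \<in> L2_space P"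
      then obtain k where k: "k \<in> L2_space \<mu>" "?I k = ?m \<psi>"
        using main by metis
      show "krein_feller \<mu> (?m \<psi>) \<in> L2_space \<mu>"
        unfolding k(2)[symmetric] by (rule krein_feller_set_integral_function[OF k(1)])
    next
      fix h \<psi> assume h: "h \<in> L2_space \<mu>" and "\<psi> \<in> L2_space P"
      then obtain k where k: "k \<in> L2_space \<mu>" "?I k = ?m \<psi>" "L2_inner P (V h) \<psi> = L2_inner \<mu> h k"
        using main by metis
      note kf = krein_feller_set_integral_function[OF k(1)]
      \<comment> \<open>The Krein-Feller derivative returns \<open>k\<close> only up to a null set,
        which the inner product ignores.\<close>
      have "L2_inner \<mu> h k = L2_inner \<mu> h (krein_feller \<mu> (?I k))"
        using kf h k(1) by (intro L2_inner_cong_AE) auto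
      then show "L2_inner P (V h) \<psi> = L2_inner \<mu> h (krein_feller \<mu> (?m \<psi>))"
        by (simp only: k(2,3))
    qed
  qed
qed

end
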